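(* Let $s\ge 1$ and $m_1\ge m_2\ge\dots\ge m_s\ge 1$ be integers, and let $R(N_{m_1,\dots,m_s},s)$ be the complex solvable Leibniz algebra with basis $\{e_i^t : 1\le t\le s,\ 1\le i\le m_t\}\cup\{x_1,\dots,x_s\}$ and multiplication $$\begin{array}{ll} [e^t_i,e^1_1]=e^t_{i+1}, & 1\leq t\leq s,\ 1\leq i\leq m_t-1,\\ {}[e^1_i,x_1]=i\,e^1_i, & 1\leq i\leq m_1,\\ {}[e^t_i,x_1]=(i-1)e^t_i, & 2\leq t\leq s,\ 2\leq i\leq m_t,\\ {}[e^t_i,x_t]=e^t_i, & 2\leq t\leq s,\ 1\leq i\leq m_t,\\ {}[x_1,e^1_1]=-e^1_1, & \end{array}$$ all other products of basis elements being zero. Then every local derivation on $R(N_{m_1,\dots,m_s},s)$ is a derivation.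
   Context: A (right) Leibniz algebra is a vector space $\mathcal L$ with a bilinear bracket satisfying $[x,[y,z]]=[[x,y],z]-[[x,z],y]$ for all $x,y,z$. A derivation of $\mathcal L$ is a linear map $D:\mathcal L\to\mathcal L$ with $D([x,y])=[D(x),y]+[x,D(y)]$ for all $x,y\in\mathcal L$. A local derivation of $\mathcal L$ is a linear map $\Delta:\mathcal L\to\mathcal L$ such that for every $x\in\mathcal L$ there is a derivation $D_x$ of $\mathcal L$ (depending on $x$) with $\Delta(x)=D_x(x)$. *)

theory Defs
  imports Complex_Main
begin

locale leibniz_algebra = vector_space scale
  for scale :: "'f::field \<Rightarrow> 'v::ab_group_add \<Rightarrow> 'v" (infixr \<open>*s\<close> 75) +
  fixes bracket :: "'v \<Rightarrow> 'v \<Rightarrow> 'v"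
  assumes linear_left: "Vector_Spaces.linear scale scale (\<lambda>x. bracket x y)"
    and linear_right: "Vector_Spaces.linear scale scale (\<lambda>y. bracket x y)"
    and leibniz: "bracket x (bracket y z) = bracket (bracket x y) z - bracket (bracket x z) y"
begin

definition derivation :: "('v \<Rightarrow> 'v) \<Rightarrow> bool" where
  "derivation D \<longleftrightarrow> Vector_Spaces.linear scale scale D \<and>
     (\<forall>x y. D (bracket x y) = bracket (D x) y + bracket x (D y))"

definition local_derivation :: "('v \<Rightarrow> 'v) \<Rightarrow> bool" where
  "local_derivation \<Delta> \<longleftrightarrow> Vector_Spaces.linear scale scale \<Delta> \<and>
     (\<forall>x. \<exists>D. derivation D \<and> \<Delta> x = D x)"

end

text \<open>Labels of the basis: \<open>E t i\<close> stands for $e_i^t$ (upper index first) and \<open>X t\<close> for $x_t$.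
  All indices start at 1; labels outside \<open>R_indices s m\<close> carry no meaning.\<close>

datatype R_index = E nat nat | X nat

definition R_indices :: "nat \<Rightarrow> (nat \<Rightarrow> nat) \<Rightarrow> R_index set" where
  "R_indices s m = {E t i | t i. t \<in> {1..s} \<and> i \<in> {1..m t}} \<union> {X t | t. t \<in> {1..s}}"

text \<open>The product of two basis elements. In the case of $[e^t_i, x_1]$ with $t \ge 2$ the formula
  gives $0$ for $i = 1$, so the restriction $i \ge 2$ is not needed.\<close>

fun R_table :: "(complex \<Rightarrow> 'v::ab_group_add \<Rightarrow> 'v) \<Rightarrow> (nat \<Rightarrow> nat) \<Rightarrow> (R_index \<Rightarrow> 'v) \<Rightarrow>
    R_index \<Rightarrow> R_index \<Rightarrow> 'v" where
  "R_table scale m b (E t i) (E u j) =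
     (if u = 1 \<and> j = 1 \<and> i + 1 \<le> m t then b (E t (i + 1)) else 0)"
| "R_table scale m b (E t i) (X u) =
     (if t = 1 \<and> u = 1 then scale (of_nat i) (b (E 1 i))
      else if t \<ge> 2 \<and> u = 1 then scale (of_nat i - 1) (b (E t i))
      else if t \<ge> 2 \<and> u = t then b (E t i)
      else 0)"
| "R_table scale m b (X u) (E t i) =
     (if u = 1 \<and> t = 1 \<and> i = 1 then - b (E 1 1) else 0)"
| "R_table scale m b (X u) (X w) = 0"

locale R_algebra = leibniz_algebra scale bracket
  for scale :: "complex \<Rightarrow> 'v::ab_group_add \<Rightarrow> 'v" (infixr \<open>*s\<close> 75)
    and bracket :: "'v \<Rightarrow> 'v \<Rightarrow> 'v" +
  fixes s :: nat and m :: "nat \<Rightarrow> nat" and b :: "R_index \<Rightarrow> 'v"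
  assumes basis_inj: "inj_on b (R_indices s m)"
    and basis_independent: "independent (b ` R_indices s m)"
    and basis_span: "span (b ` R_indices s m) = UNIV"
    and bracket_basis: "\<And>p q. p \<in> R_indices s m \<Longrightarrow> q \<in> R_indices s m \<Longrightarrow>
      bracket (b p) (b q) = R_table scale m b p q"

end

theory Submission
  imports Defs
begin

text \<open>
  The only basis elements with a nonzero right multiplication \<open>v \<mapsto> [v, z]\<close> are \<open>e\<^sub>1\<^sup>1\<close> and
  \<open>x\<^sub>1, \<dots>, x\<^sub>s\<close>. The \<open>x\<^sub>t\<close> act diagonally, and \<open>e\<^sub>1\<^sup>1\<close> shifts every chain \<open>e\<^sub>1\<^sup>t, e\<^sub>2\<^sup>t, \<dots>\<close>
  one step forward. So \<open>[v, z]\<close> depends on \<open>z\<close> only through \<open>s + 1\<close> parameters, a shift coefficient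
  \<open>\<alpha>\<close> and the diagonal coefficients \<open>\<beta>\<^sub>1, \<dots>, \<beta>\<^sub>s\<close>, and in coordinates
  \<open>[v, z]\<^bsub>t,i\<^esub> = ((i - 1) \<beta>\<^sub>1 + \<beta>\<^sub>t) v\<^bsub>t,i\<^esub> + \<alpha> v\<^bsub>t,i-1\<^esub>\<close>,
  where for \<open>t = i = 1\<close> the last coordinate is replaced by minus the coordinate at \<open>x\<^sub>1\<close>
  (\<open>coord_E_bracket\<close>).

  Every derivation \<open>D\<close> is a right multiplication (\<open>derivation_inner\<close>). Applying \<open>D\<close> to
  \<open>[x\<^sub>t, x\<^sub>u] = 0\<close> shows that the \<open>e\<close>-part of \<open>D x\<^sub>t\<close> is a multiple of \<open>e\<^sub>1\<^sup>1\<close>, and is zero unless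
  \<open>t = 1\<close>. Applying \<open>D\<close> to \<open>[e\<^sub>i\<^sup>r, x\<^sub>t]\<close> shows that \<open>D\<close> respects the joint eigenspaces of the
  \<open>x\<^sub>t\<close> up to that multiple of the shift. These eigenspaces are lines on the \<open>e\<close>-part, so only the
  eigenvalues are left, and \<open>[e\<^sub>i\<^sup>r, e\<^sub>1\<^sup>1] = e\<^bsub>i+1\<^esub>\<^sup>r\<close> expresses them through those at the heads of
  the chains.

  A local derivation \<open>\<Delta>\<close> is therefore a linear map that agrees at each vector with some right
  multiplication. Subtracting one right multiplication makes the coefficients of \<open>\<Delta> x\<^sub>1\<close> at
  \<open>e\<^sub>1\<^sup>1\<close> and of \<open>\<Delta> e\<^sub>1\<^sup>t\<close> at \<open>e\<^sub>1\<^sup>t\<close> vanish; the difference \<open>\<Phi>\<close> is then zero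
  (\<open>locally_inner_eq_zero\<close>). For this, \<open>\<Phi>\<close> is evaluated at sums of a few basis vectors whose
  coordinates where \<open>\<Phi>\<close> is already known determine the local parameters \<open>\<alpha>\<close> and \<open>\<beta>\<^sub>t\<close>,
  and these parameters then determine the remaining coordinates.
\<close>

section \<open>Right multiplications\<close>

context leibniz_algebra
begin

sublocale left: Vector_Spaces.linear scale scale "\<lambda>x. bracket x z" for z
  by (rule linear_left)

sublocale right: Vector_Spaces.linear scale scale "\<lambda>z. bracket x z" for x
  by (rule linear_right)

text \<open>This is the Leibniz identity, solved for \<open>[[x, y], z]\<close>.\<close>

lemma right_multiplication_derivation: "derivation (\<lambda>x. bracket x z)"
  unfolding derivation_def using linear_left leibniz by (simp add: algebra_simps)

end

section \<open>Coordinates\<close>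

locale R_algebra_longest_first = R_algebra +
  assumes s_pos: "1 \<le> s"
    and m_first: "\<And>t. t \<in> {1..s} \<Longrightarrow> m t \<le> m 1"
    and m_pos: "\<And>t. t \<in> {1..s} \<Longrightarrow> 1 \<le> m t"
begin

abbreviation I :: "R_index set" where "I \<equiv> R_indices s m"

lemma E_in_I [simp]: "E t i \<in> I \<longleftrightarrow> 1 \<le> t \<and> t \<le> s \<and> 1 \<le> i \<and> i \<le> m t"
  by (auto simp: R_indices_def)

lemma X_in_I [simp]: "X t \<in> I \<longleftrightarrow> 1 \<le> t \<and> t \<le> s"
  by (auto simp: R_indices_def)

lemma E_1_in_I: "1 \<le> t \<Longrightarrow> t \<le> s \<Longrightarrow> E t 1 \<in> I"
  using m_pos by simp

text \<open>Labels outside the index set get coordinate \<open>0\<close>, so that the predecessor \<open>E t (i - 1)\<close> of the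
  head of a chain contributes nothing.\<close>

definition coord :: "R_index \<Rightarrow> 'a \<Rightarrow> complex" where
  "coord p v = (if p \<in> I then representation (b ` I) v (b p) else 0)"

lemma coord_add [simp]: "coord p (v + w) = coord p v + coord p w"
  by (simp add: coord_def representation_add basis_independent basis_span)

lemma coord_scale [simp]: "coord p (c *s v) = c * coord p v"
  by (simp add: coord_def representation_scale basis_independent basis_span)

lemma coord_minus [simp]: "coord p (- v) = - coord p v"
  by (simp add: coord_def representation_neg basis_independent basis_span)

lemma coord_diff [simp]: "coord p (v - w) = coord p v - coord p w"
  by (simp add: coord_def representation_diff basis_independent basis_span)

lemma coord_zero [simp]: "coord p 0 = 0"
  by (simp add: coord_def representation_zero)

lemma coord_sum [simp]: "coord p (sum f A) = (\<Sum>x\<in>A. coord p (f x))"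
  by (induction A rule: infinite_finite_induct) auto

lemma coord_basis: "q \<in> I \<Longrightarrow> coord p (b q) = (if p = q then 1 else 0)"
  using inj_onD[OF basis_inj] by (auto simp: coord_def representation_basis basis_independent)

lemma coord_eqI:
  assumes "\<And>p. p \<in> I \<Longrightarrow> coord p v = coord p w"
  shows "v = w"
proof -
  have "representation (b ` I) v x = representation (b ` I) w x" for x
  proof (cases "x \<in> b ` I")
    case True
    then show ?thesis using assms by (auto simp: coord_def)
  next
    case False
    then show ?thesis using representation_ne_zero by metis
  qed
  then have "representation (b ` I) v = representation (b ` I) w" by blast
  moreover have "(\<Sum>x | representation (b ` I) u x \<noteq> 0. representation (b ` I) u x *s x) = u" for u
    using basis_independent basis_span by (intro sum_nonzero_representation_eq) auto
  ultimately show ?thesis by metis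
qed

lemma coord_E_X_eqI:
  assumes "\<And>t i. E t i \<in> I \<Longrightarrow> coord (E t i) v = coord (E t i) w"
    and "\<And>t. X t \<in> I \<Longrightarrow> coord (X t) v = coord (X t) w"
  shows "v = w"
  using assms by (metis coord_eqI R_index.exhaust)

lemma basis_induct:
  assumes "P 0" and "\<And>c p v. p \<in> I \<Longrightarrow> P v \<Longrightarrow> P (c *s b p + v)"
  shows "P v"
  using span_induct_alt[of v "b ` I" P] assms basis_span by auto

text \<open>The eigenvalue of \<open>v \<mapsto> [v, z]\<close> at \<open>e\<^sub>i\<^sup>t\<close> for \<open>z\<close> in the span of the \<open>x\<^sub>u\<close>. The two cases \<open>t = 1\<close>
  and \<open>t \<ge> 2\<close> of the multiplication table share this formula: for \<open>t = 1\<close> the two summands add up to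
  \<open>i\<close> times the coordinate at \<open>x\<^sub>1\<close>.\<close>

definition weight :: "nat \<Rightarrow> nat \<Rightarrow> 'a \<Rightarrow> complex" where
  "weight t i z = (of_nat i - 1) * coord (X 1) z + coord (X t) z"

text \<open>The coordinate at \<open>e\<^sub>i\<^sup>t\<close> of \<open>[v, e\<^sub>1\<^sup>1]\<close>. Since
  \<open>[x\<^sub>1, e\<^sub>1\<^sup>1] = -e\<^sub>1\<^sup>1\<close>, the element \<open>-x\<^sub>1\<close> behaves like a predecessor of \<open>e\<^sub>1\<^sup>1\<close>.\<close>

definition shift :: "nat \<Rightarrow> nat \<Rightarrow> 'a \<Rightarrow> complex" where
  "shift t i v = (if t = 1 \<and> i = 1 then - coord (X 1) v else coord (E t (i - 1)) v)"

lemma shift_linear [simp]: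
  "shift t i 0 = 0" "shift t i (v + w) = shift t i v + shift t i w"
  "shift t i (v - w) = shift t i v - shift t i w"
  "shift t i (c *s v) = c * shift t i v"
  by (simp_all add: shift_def)

lemma weight_linear [simp]:
  "weight t i 0 = 0" "weight t i (v + w) = weight t i v + weight t i w"
  "weight t i (c *s v) = c * weight t i v"
  by (simp_all add: weight_def algebra_simps)

lemma coord_E_table:
  assumes "p \<in> I" "q \<in> I" "E t i \<in> I"
  shows "coord (E t i) (R_table scale m b p q) =
    weight t i (b q) * coord (E t i) (b p) + coord (E 1 1) (b q) * shift t i (b p)"
  using assms s_pos
  by (cases p; cases q) (auto simp: coord_basis weight_def shift_def)

text \<open>Both sides are bilinear in \<open>(v, z)\<close>, so the multiplication table decides. Together with
  \<open>coord_X_bracket\<close> this describes the bracket completely.\<close>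

lemma coord_E_bracket:
  assumes "E t i \<in> I"
  shows "coord (E t i) (bracket v z) =
    weight t i z * coord (E t i) v + coord (E 1 1) z * shift t i v"
proof (induction v rule: basis_induct)
  case 1
  show ?case by (simp add: left.zero)
next
  case (2 c p v)
  have "coord (E t i) (bracket (b p) z) =
    weight t i z * coord (E t i) (b p) + coord (E 1 1) z * shift t i (b p)"
  proof (induction z rule: basis_induct)
    case 1
    show ?case by (simp add: right.zero)
  next
    case (2 c q z)
    with \<open>p \<in> I\<close> assms show ?case
      by (simp add: right.add right.scale bracket_basis coord_E_table algebra_simps del: E_in_I)
  qed
  with 2 show ?case by (simp add: left.add left.scale algebra_simps)
qed

lemma coord_X_bracket: "coord (X t) (bracket v z) = 0"
proof (induction v rule: basis_induct)
  case 1
  show ?case by (simp add: left.zero)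
next
  case (2 c p v)
  have "coord (X t) (bracket (b p) z) = 0"
  proof (induction z rule: basis_induct)
    case 1
    show ?case by (simp add: right.zero)
  next
    case (2 c q z)
    have "coord (X t) (R_table scale m b p q) = 0"
      using \<open>p \<in> I\<close> \<open>q \<in> I\<close> by (cases p; cases q) (auto simp: coord_basis)
    with 2 \<open>p \<in> I\<close> show ?case by (simp add: right.add right.scale bracket_basis)
  qed
  with 2 show ?case by (simp add: left.add left.scale)
qed

lemma weight_X: "1 \<le> u \<Longrightarrow> u \<le> s \<Longrightarrow>
    weight t i (b (X u)) = (if u = 1 then of_nat i - 1 else 0) + (if u = t then 1 else 0)"
  by (auto simp: weight_def coord_basis)

lemma shift_X: "1 \<le> u \<Longrightarrow> u \<le> s \<Longrightarrow>
    shift t i (b (X u)) = (if t = 1 \<and> i = 1 \<and> u = 1 then - 1 else 0)"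
  by (auto simp: shift_def coord_basis)

lemma shift_E: "E r j \<in> I \<Longrightarrow> 1 \<le> i \<Longrightarrow>
    shift t i (b (E r j)) = (if t = r \<and> i = j + 1 then 1 else 0)"
  by (auto simp: shift_def coord_basis)

lemma bracket_E_X:
  assumes "E t i \<in> I" "1 \<le> u" "u \<le> s"
  shows "bracket (b (E t i)) (b (X u)) = weight t i (b (X u)) *s b (E t i)"
  using assms by (intro coord_E_X_eqI)
    (auto simp: coord_E_bracket coord_X_bracket coord_basis)

lemma bracket_E_E11:
  assumes "E t i \<in> I" "i + 1 \<le> m t"
  shows "bracket (b (E t i)) (b (E 1 1)) = b (E t (i + 1))"
  using assms m_pos s_pos by (simp add: bracket_basis)

lemma ex_inner_parameters:
  "\<exists>z. coord (E 1 1) z = \<alpha> \<and> (\<forall>t. 1 \<le> t \<and> t \<le> s \<longrightarrow> coord (X t) z = \<beta> t)"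
proof (intro exI conjI allI impI)
  let ?z = "\<alpha> *s b (E 1 1) + (\<Sum>u\<in>{1..s}. \<beta> u *s b (X u))"
  show "coord (E 1 1) ?z = \<alpha>"
    using E_1_in_I[of 1] s_pos by (simp add: coord_basis)
  fix t assume t: "1 \<le> t \<and> t \<le> s"
  then show "coord (X t) ?z = \<beta> t"
    using E_1_in_I[of 1] s_pos
    by (simp add: coord_basis if_distrib[of "\<lambda>c. _ * c"] cong: if_cong)
qed

section \<open>Every derivation is a right multiplication\<close>

text \<open>The derivation rule is applied to \<open>[x\<^sub>t, x\<^sub>r] = 0\<close>. The term \<open>[x\<^sub>t, D x\<^sub>r]\<close> is a multiple of
  \<open>e\<^sub>1\<^sup>1\<close> and vanishes unless \<open>t = 1\<close>, while \<open>x\<^sub>r\<close> acts on \<open>e\<^sub>i\<^sup>r\<close> with a nonzero weight.\<close>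

lemma derivation_X_coord_E:
  assumes D: "derivation D" and t: "1 \<le> t" "t \<le> s" and E: "E r i \<in> I"
    and ne: "\<not> (r = 1 \<and> i = 1 \<and> t = 1)"
  shows "coord (E r i) (D (b (X t))) = 0"
proof -
  interpret D: Vector_Spaces.linear scale scale D using D by (simp add: derivation_def)
  have r: "1 \<le> r" "r \<le> s" using E by auto
  have "bracket (b (X t)) (b (X r)) = 0" using t r by (simp add: bracket_basis)
  then have "bracket (D (b (X t))) (b (X r)) + bracket (b (X t)) (D (b (X r))) = 0"
    using D D.zero unfolding derivation_def by metis
  then have "coord (E r i) (bracket (D (b (X t))) (b (X r))) +
      coord (E r i) (bracket (b (X t)) (D (b (X r)))) = 0"
    by (metis coord_add coord_zero)
  then have "weight r i (b (X r)) * coord (E r i) (D (b (X t))) = 0"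
    using E ne r t by (simp add: coord_E_bracket coord_basis shift_X split: if_splits)
  moreover have "weight r i (b (X r)) \<noteq> 0"
    using E r by (auto simp: weight_X)
  ultimately show ?thesis by simp
qed

text \<open>The derivation rule for \<open>[e\<^sub>i\<^sup>r, x\<^sub>t]\<close>, read off at \<open>e\<^bsub>i'\<^esub>\<^bsup>r'\<^esup>\<close>. It is the main source of information
  about \<open>D\<close>: its diagonal case shows that \<open>D x\<^sub>t\<close> has no torus part, and its off-diagonal
  cases compare weights.\<close>

lemma derivation_E_X_coord_E:
  assumes D: "derivation D" and t: "1 \<le> t" "t \<le> s" and E: "E r i \<in> I" and E': "E r' i' \<in> I"
  shows "(weight r i (b (X t)) - weight r' i' (b (X t))) * coord (E r' i') (D (b (E r i))) =
    weight r' i' (D (b (X t))) * (if r' = r \<and> i' = i then 1 else 0)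
     + coord (E 1 1) (D (b (X t))) * (if r' = r \<and> i' = i + 1 then 1 else 0)"
proof -
  interpret D: Vector_Spaces.linear scale scale D using D by (simp add: derivation_def)
  have "weight r i (b (X t)) *s D (b (E r i)) =
      bracket (D (b (E r i))) (b (X t)) + bracket (b (E r i)) (D (b (X t)))"
    using D t E by (metis bracket_E_X derivation_def D.scale)
  then have "coord (E r' i') (weight r i (b (X t)) *s D (b (E r i))) =
      coord (E r' i') (bracket (D (b (E r i))) (b (X t)) + bracket (b (E r i)) (D (b (X t))))"
    by simp
  then show ?thesis
    using t E E' by (simp add: coord_E_bracket coord_basis shift_E algebra_simps)
qed

text \<open>Brackets have no torus part, and \<open>e\<^sub>i\<^sup>r\<close> is a nonzero multiple of the bracket
  \<open>[e\<^sub>i\<^sup>r, x\<^sub>r]\<close>.\<close>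

lemma derivation_E_coord_X:
  assumes D: "derivation D" and E: "E r i \<in> I"
  shows "coord (X u) (D (b (E r i))) = 0"
proof -
  interpret D: Vector_Spaces.linear scale scale D using D by (simp add: derivation_def)
  have r: "1 \<le> r" "r \<le> s" using E by auto
  have "weight r i (b (X r)) *s D (b (E r i)) =
      bracket (D (b (E r i))) (b (X r)) + bracket (b (E r i)) (D (b (X r)))"
    using D r E by (metis bracket_E_X derivation_def D.scale)
  then have "coord (X u) (weight r i (b (X r)) *s D (b (E r i))) =
      coord (X u) (bracket (D (b (E r i))) (b (X r)) + bracket (b (E r i)) (D (b (X r))))"
    by simp
  then have "weight r i (b (X r)) * coord (X u) (D (b (E r i))) = 0"
    by (simp add: coord_X_bracket)
  moreover have "weight r i (b (X r)) \<noteq> 0"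
    using E r by (auto simp: weight_X)
  ultimately show ?thesis by simp
qed

lemma derivation_X_coord_X:
  assumes D: "derivation D" and t: "1 \<le> t" "t \<le> s" and u: "1 \<le> u" "u \<le> s"
  shows "coord (X u) (D (b (X t))) = 0"
  using derivation_E_X_coord_E[OF D t E_1_in_I[OF u] E_1_in_I[OF u]] by (simp add: weight_def)

text \<open>Distinct \<open>e\<close>-basis vectors have distinct weights under \<open>x\<^sub>1, \<dots>, x\<^sub>s\<close>: within one chain \<open>x\<^sub>1\<close>
  separates them.\<close>

lemma derivation_E_coord_E:
  assumes D: "derivation D" and E: "E r i \<in> I" and E': "E r' i' \<in> I"
    and ne: "(r', i') \<noteq> (r, i)"
  shows "coord (E r' i') (D (b (E r i))) =
    (if r' = r \<and> i' = i + 1 then - coord (E 1 1) (D (b (X 1))) else 0)"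
proof (cases "r' = r")
  case True
  have "(of_nat i - of_nat i') * coord (E r' i') (D (b (E r i))) =
     coord (E 1 1) (D (b (X 1))) * (if i' = i + 1 then 1 else 0)"
    using derivation_E_X_coord_E[OF D _ _ E E', of 1] ne s_pos True
    by (auto simp: weight_X split: if_splits)
  moreover have "(of_nat i - of_nat i' :: complex) \<noteq> 0" using ne True by simp
  ultimately show ?thesis using True by (auto simp: eq_neg_iff_add_eq_0 neg_eq_iff_add_eq_0 split: if_splits)
next
  case False
  \<comment> \<open>Two chains are separated by an \<open>x\<^sub>t\<close> with \<open>t \<ge> 2\<close>, which is \<open>1\<close> on chain \<open>t\<close> and \<open>0\<close> on the other.\<close>
  define t where "t = (if r = 1 then r' else r)"
  have t: "1 \<le> t" "t \<le> s" "t \<noteq> 1" using False E E' by (auto simp: t_def)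
  have "weight r i (b (X t)) - weight r' i' (b (X t)) \<noteq> 0"
    using t False by (auto simp: weight_X t_def)
  then show ?thesis
    using derivation_E_X_coord_E[OF D t(1,2) E E'] False by simp
qed

text \<open>The rule for \<open>[e\<^sub>i\<^sup>r, e\<^sub>1\<^sup>1] = e\<^bsub>i+1\<^esub>\<^sup>r\<close> makes the eigenvalues along a chain an arithmetic
  progression whose step is the eigenvalue at \<open>e\<^sub>1\<^sup>1\<close>.\<close>

lemma derivation_E_diagonal:
  assumes D: "derivation D" and E: "E r i \<in> I"
  shows "coord (E r i) (D (b (E r i))) =
    (of_nat i - 1) * coord (E 1 1) (D (b (E 1 1))) + coord (E r 1) (D (b (E r 1)))"
  using E
proof (induction i)
  case 0
  then show ?case by simp
next
  case (Suc i)
  show ?case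
  proof (cases "i = 0")
    case True
    then show ?thesis by simp
  next
    case False
    then have E: "E r i \<in> I" using Suc.prems by auto
    have E11: "E 1 1 \<in> I" using E_1_in_I s_pos by blast
    have "b (E r (Suc i)) = bracket (b (E r i)) (b (E 1 1))"
      using bracket_E_E11[OF E] Suc.prems by simp
    then have "D (b (E r (Suc i))) =
        bracket (D (b (E r i))) (b (E 1 1)) + bracket (b (E r i)) (D (b (E 1 1)))"
      using D by (simp add: derivation_def)
    then have "coord (E r (Suc i)) (D (b (E r (Suc i)))) =
        shift r (Suc i) (D (b (E r i))) + coord (E 1 1) (D (b (E 1 1)))"
      using Suc.prems E E11
      by (simp add: coord_E_bracket coord_basis shift_E weight_def del: One_nat_def)
    also have "shift r (Suc i) (D (b (E r i))) = coord (E r i) (D (b (E r i)))"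
      using False by (simp add: shift_def)
    finally show ?thesis using Suc.IH[OF E] by (simp add: algebra_simps)
  qed
qed

text \<open>The parameters of \<open>z\<close> are forced: \<open>[x\<^sub>1, e\<^sub>1\<^sup>1] = -e\<^sub>1\<^sup>1\<close> gives the shift coefficient, and the head of
  the chain \<open>t\<close> has eigenvalue the coordinate of \<open>z\<close> at \<open>x\<^sub>t\<close>.\<close>

lemma derivation_inner:
  assumes D: "derivation D"
  obtains z where "\<And>v. D v = bracket v z"
proof -
  interpret D: Vector_Spaces.linear scale scale D using D by (simp add: derivation_def)
  obtain z where \<alpha>: "coord (E 1 1) z = - coord (E 1 1) (D (b (X 1)))"
    and \<beta>: "\<And>t. 1 \<le> t \<Longrightarrow> t \<le> s \<Longrightarrow> coord (X t) z = coord (E t 1) (D (b (E t 1)))"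
    using ex_inner_parameters[of "- coord (E 1 1) (D (b (X 1)))" "\<lambda>t. coord (E t 1) (D (b (E t 1)))"]
    by blast
  have basis: "D (b p) = bracket (b p) z" if p: "p \<in> I" for p
  proof (cases p)
    case (E r i)
    show ?thesis
    proof (rule coord_E_X_eqI)
      fix r' i' assume E': "E r' i' \<in> I"
      show "coord (E r' i') (D (b p)) = coord (E r' i') (bracket (b p) z)"
      proof (cases "(r', i') = (r, i)")
        case True
        then show ?thesis
          using p E s_pos derivation_E_diagonal[OF D, of r i] \<beta>
          by (simp add: coord_E_bracket coord_basis shift_E weight_def del: One_nat_def)
      next
        case False
        then show ?thesis
          using p E E' derivation_E_coord_E[OF D _ E' False] \<alpha>
          by (auto simp: coord_E_bracket coord_basis shift_E simp del: One_nat_def)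
      qed
    qed (use p E in \<open>simp add: derivation_E_coord_X[OF D] coord_X_bracket\<close>)
  next
    case (X t)
    then have t: "1 \<le> t" "t \<le> s" using p by auto
    show ?thesis
    proof (rule coord_E_X_eqI)
      fix r i assume E: "E r i \<in> I"
      then show "coord (E r i) (D (b p)) = coord (E r i) (bracket (b p) z)"
        using derivation_X_coord_E[OF D t E] X t \<alpha>
        by (auto simp: coord_E_bracket coord_basis shift_X)
    qed (use X t in \<open>simp add: derivation_X_coord_X[OF D] coord_X_bracket\<close>)
  qed
  have "D v = bracket v z" for v
    by (induction v rule: basis_induct)
      (simp_all add: D.zero D.add D.scale left.zero left.add left.scale basis)
  then show ?thesis using that by blast
qed

section \<open>Locally inner maps\<close>

lemma locally_inner_coord:
  assumes "\<And>v. \<exists>z. \<Phi> v = bracket v z"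
  shows "\<exists>\<alpha> \<beta>. \<forall>t i. E t i \<in> I \<longrightarrow>
    coord (E t i) (\<Phi> v) = ((of_nat i - 1) * \<beta> 1 + \<beta> t) * coord (E t i) v + \<alpha> * shift t i v"
proof -
  obtain z where "\<Phi> v = bracket v z" using assms by blast
  then show ?thesis
    by (intro exI[of _ "coord (E 1 1) z"] exI[of _ "\<lambda>t. coord (X t) z"])
      (simp add: coord_E_bracket weight_def)
qed

text \<open>The two normalisations kill the coefficients that a right multiplication could account for. That
  the others vanish follows from suitable test vectors, each of which has its own parameters
  \<open>\<alpha>\<close> and \<open>\<beta>\<close>. The step along the chain from \<open>e\<^sub>1\<^sup>1\<close> to \<open>e\<^sub>2\<^sup>1\<close> is the delicate one.
  The coefficient of \<open>\<Phi> e\<^sub>1\<^sup>1\<close> at \<open>e\<^sub>2\<^sup>1\<close> cannot be isolated by adding just \<open>x\<^sub>1\<close> to \<open>e\<^sub>1\<^sup>1\<close>, since at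
  \<open>e\<^sub>1\<^sup>1\<close> the contributions of \<open>\<alpha>\<close> and \<open>\<beta>\<^sub>1\<close> may cancel.\<close>

lemma locally_inner_eq_zero:
  assumes lin: "Vector_Spaces.linear scale scale \<Phi>"
    and loc: "\<And>v. \<exists>z. \<Phi> v = bracket v z"
    and x1: "coord (E 1 1) (\<Phi> (b (X 1))) = 0"
    and diag1: "\<And>t. 1 \<le> t \<Longrightarrow> t \<le> s \<Longrightarrow> coord (E t 1) (\<Phi> (b (E t 1))) = 0"
  shows "\<Phi> v = 0"
proof -
  interpret \<Phi>: Vector_Spaces.linear scale scale \<Phi> by (rule lin)
  note local = locally_inner_coord[of \<Phi>, OF loc]
  have E11: "E 1 1 \<in> I" using E_1_in_I s_pos by blast
  have coord_X: "coord (X u) (\<Phi> v) = 0" for u v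
    using loc[of v] coord_X_bracket by auto
  have X_zero: "\<Phi> (b (X t)) = 0" if t: "1 \<le> t" "t \<le> s" for t
  proof (rule coord_E_X_eqI)
    fix r i assume E: "E r i \<in> I"
    show "coord (E r i) (\<Phi> (b (X t))) = coord (E r i) 0"
      using local[of "b (X t)"] E t x1
      by (cases "r = 1 \<and> i = 1 \<and> t = 1") (auto simp: coord_basis shift_X)
  qed (simp add: coord_X)
  have coord_off: "coord (E r' i') (\<Phi> (b (E r i))) = 0"
    if "E r i \<in> I" "E r' i' \<in> I" "(r', i') \<noteq> (r, i)" "(r', i') \<noteq> (r, i + 1)" for r i r' i'
    using local[of "b (E r i)"] that by (auto simp: coord_basis shift_E)
  have coord_next: "coord (E r (i + 1)) (\<Phi> (b (E r i))) = 0"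
    if E: "E r i \<in> I" "E r (i + 1) \<in> I" and ne: "(r, i) \<noteq> (1, 1)" for r i
  proof -
    \<comment> \<open>Adding \<open>x\<^sub>1\<close> makes \<open>- \<alpha>\<close> visible at \<open>e\<^sub>1\<^sup>1\<close>, where \<open>e\<^sub>i\<^sup>r\<close> does not interfere.\<close>
    obtain \<alpha> \<beta> where ab: "\<And>t i'. E t i' \<in> I \<Longrightarrow> coord (E t i') (\<Phi> (b (X 1) + b (E r i))) =
       ((of_nat i' - 1) * \<beta> 1 + \<beta> t) * coord (E t i') (b (X 1) + b (E r i))
       + \<alpha> * shift t i' (b (X 1) + b (E r i))"
      using local[of "b (X 1) + b (E r i)"] by blast
    have "\<alpha> = 0"
      using ab[OF E11] coord_off[OF E(1) E11] E ne s_pos X_zero[of 1]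
      by (auto simp: \<Phi>.add coord_basis shift_X shift_E split: if_splits)
    then show ?thesis
      using ab[OF E(2)] E s_pos X_zero[of 1]
      by (simp add: \<Phi>.add coord_basis shift_X shift_E)
  qed
  have first: "coord (E 1 2) (\<Phi> (b (E 1 1))) = 0 \<and> coord (E 1 2) (\<Phi> (b (E 1 2))) = 0"
    if E12: "E 1 2 \<in> I"
  proof -
    have eq: "2 * k * coord (E 1 2) (\<Phi> (b (E 1 1))) = coord (E 1 2) (\<Phi> (b (E 1 2)))"
      if k: "k * k = 1" for k :: complex
    proof -
      \<comment> \<open>The coefficients are chosen so that the relation \<open>\<alpha> = \<beta>\<^sub>1 k\<close>, which holds at \<open>e\<^sub>1\<^sup>1\<close>, makes the
         unknown parameters cancel at \<open>e\<^sub>2\<^sup>1\<close> as well: there they contribute \<open>2 k \<alpha> - 2 \<beta>\<^sub>1\<close>.\<close>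
      let ?v = "2 *s b (X 1) + ((2 * k) *s b (E 1 1) - b (E 1 2))"
      obtain \<alpha> \<beta> where ab: "\<And>t i. E t i \<in> I \<Longrightarrow> coord (E t i) (\<Phi> ?v) =
         ((of_nat i - 1) * \<beta> 1 + \<beta> t) * coord (E t i) ?v + \<alpha> * shift t i ?v"
        using local[of ?v] by blast
      have "\<alpha> = \<beta> 1 * k"
        using ab[OF E11] coord_off[OF E12 E11] diag1[of 1] E11 E12 s_pos X_zero[of 1]
        by (simp add: \<Phi>.add \<Phi>.diff \<Phi>.scale coord_basis shift_X shift_E del: One_nat_def E_in_I)
      moreover have "2 * k * coord (E 1 2) (\<Phi> (b (E 1 1))) - coord (E 1 2) (\<Phi> (b (E 1 2))) =
          2 * k * \<alpha> - 2 * \<beta> 1"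
        using ab[OF E12] E11 E12 s_pos X_zero[of 1]
        by (simp add: \<Phi>.add \<Phi>.diff \<Phi>.scale coord_basis shift_X shift_E del: One_nat_def E_in_I)
      ultimately show ?thesis using k by algebra
    qed
    \<comment> \<open>The two signs of \<open>k\<close> separate the two coefficients.\<close>
    show ?thesis using eq[of 1] eq[of "-1"] by (simp add: neg_eq_iff_add_eq_0 flip: mult_2)
  qed
  have coord_diag: "coord (E r i) (\<Phi> (b (E r i))) = 0" if E: "E r i \<in> I" for r i
  proof -
    have r: "1 \<le> r" "r \<le> s" using E by auto
    consider "i = 1" | "r = 1" "i = 2" | "i \<ge> 2" "(r, i) \<noteq> (1, 2)" using E by fastforce
    then show ?thesis
    proof cases
      case 1
      then show ?thesis using diag1 r by simp
    next
      case 2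
      then show ?thesis using first E by simp
    next
      case 3
      have E12: "E 1 2 \<in> I" using E 3 m_first[of r] s_pos by simp
      have Er1: "E r 1 \<in> I" using E_1_in_I r .
      \<comment> \<open>The heads force \<open>\<beta>\<^sub>1 = 0\<close> and \<open>\<beta>\<^sub>r = 0\<close>. The parameter \<open>\<alpha>\<close>, which matters at \<open>e\<^sub>i\<^sup>r\<close> when \<open>i = 2\<close>,
         is seen at \<open>e\<^sub>2\<^sup>1\<close>; this vector exists because the first chain is the longest. For \<open>r = 1\<close>
         the test vector is \<open>2 e\<^sub>1\<^sup>1 + e\<^sub>i\<^sup>1\<close>.\<close>
      let ?v = "b (E 1 1) + (b (E r 1) + b (E r i))"
      obtain \<alpha> \<beta> where ab: "\<And>t i'. E t i' \<in> I \<Longrightarrow> coord (E t i') (\<Phi> ?v) =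
         ((of_nat i' - 1) * \<beta> 1 + \<beta> t) * coord (E t i') ?v + \<alpha> * shift t i' ?v"
        using local[of ?v] by blast
      have "\<beta> 1 = 0"
        using ab[OF E11] coord_off[OF Er1 E11] coord_off[OF E E11] diag1[of 1] E11 Er1 E s_pos 3
        by (cases "r = 1") (auto simp: \<Phi>.add coord_basis shift_E simp del: One_nat_def E_in_I)
      moreover have "\<beta> r = 0"
        using ab[OF Er1] coord_off[OF E11 Er1] coord_off[OF E Er1] diag1[of r] E11 Er1 E r 3
        by (cases "r = 1") (auto simp: \<Phi>.add coord_basis shift_E simp del: One_nat_def E_in_I)
      moreover have "\<alpha> = 0"
        using ab[OF E12] coord_off[OF Er1 E12] coord_off[OF E E12] first[OF E12] E11 E12 Er1 E 3 \<open>\<beta> 1 = 0\<close>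
        by (cases "r = 1") (auto simp: \<Phi>.add coord_basis shift_E simp del: One_nat_def E_in_I)
      ultimately have "coord (E r i) (\<Phi> ?v) = 0" using ab[OF E] by simp
      moreover have "coord (E r i) (\<Phi> (b (E u 1))) = 0" if "u = 1 \<or> u = r" for u
      proof (cases "(r, i) = (u, 1 + 1)")
        case True
        then show ?thesis using coord_next[OF Er1] E 3 that by auto
      next
        case False
        then show ?thesis using coord_off[of u 1 r i] E E11 Er1 3 that by auto
      qed
      ultimately show ?thesis by (simp add: \<Phi>.add)
    qed
  qed
  have E_zero: "\<Phi> (b (E r i)) = 0" if E: "E r i \<in> I" for r i
  proof (rule coord_E_X_eqI)
    fix r' i' assume E': "E r' i' \<in> I"
    consider "(r', i') = (r, i)" | "(r', i') = (r, i + 1)" | "(r', i') \<notin> {(r, i), (r, i + 1)}"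
      by blast
    then have "coord (E r' i') (\<Phi> (b (E r i))) = 0"
    proof cases
      case 2
      then show ?thesis
        using coord_next[OF E] first E E' by (cases "(r, i) = (1, 1)") (auto simp: numeral_2_eq_2)
    qed (use coord_diag coord_off E E' in auto)
    then show "coord (E r' i') (\<Phi> (b (E r i))) = coord (E r' i') 0" by simp
  qed (simp add: coord_X)
  have "\<Phi> (b p) = 0" if "p \<in> I" for p
    using that X_zero E_zero by (cases p) auto
  then show ?thesis
    by (induction v rule: basis_induct) (simp_all add: \<Phi>.zero \<Phi>.add \<Phi>.scale)
qed

theorem local_derivation_imp_derivation:
  assumes "local_derivation \<Delta>"
  shows "derivation \<Delta>"
proof -
  have lin: "Vector_Spaces.linear scale scale \<Delta>" and loc: "\<exists>z. \<Delta> v = bracket v z" for v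
    using assms derivation_inner unfolding local_derivation_def by metis+
  obtain z where \<alpha>: "coord (E 1 1) z = - coord (E 1 1) (\<Delta> (b (X 1)))"
    and \<beta>: "\<And>t. 1 \<le> t \<Longrightarrow> t \<le> s \<Longrightarrow> coord (X t) z = coord (E t 1) (\<Delta> (b (E t 1)))"
    using ex_inner_parameters[of "- coord (E 1 1) (\<Delta> (b (X 1)))" "\<lambda>t. coord (E t 1) (\<Delta> (b (E t 1)))"]
    by blast
  interpret pair: vector_space_pair scale scale by unfold_locales
  define \<Phi> where "\<Phi> v = \<Delta> v - bracket v z" for v
  have "Vector_Spaces.linear scale scale \<Phi>"
    unfolding \<Phi>_def using lin linear_left by (rule pair.linear_compose_sub)
  moreover have "\<exists>w. \<Phi> v = bracket v w" for v
    using loc[of v] unfolding \<Phi>_def by (metis right.diff)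
  moreover have "coord (E 1 1) (\<Phi> (b (X 1))) = 0"
    using \<alpha> E_1_in_I[of 1] s_pos
    by (simp add: \<Phi>_def coord_E_bracket coord_basis shift_X del: One_nat_def E_in_I)
  moreover have "coord (E t 1) (\<Phi> (b (E t 1))) = 0" if "1 \<le> t" "t \<le> s" for t
    using \<beta> that E_1_in_I[of t]
    by (simp add: \<Phi>_def coord_E_bracket coord_basis shift_E weight_def del: One_nat_def E_in_I)
  ultimately have "\<Phi> v = 0" for v by (rule locally_inner_eq_zero)
  then have "\<Delta> = (\<lambda>v. bracket v z)" by (auto simp: \<Phi>_def fun_eq_iff)
  then show ?thesis using right_multiplication_derivation by simp
qed

end

theorem theorem3p1:
  fixes scale :: "complex \<Rightarrow> 'v::ab_group_add \<Rightarrow> 'v"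
    and bracket :: "'v \<Rightarrow> 'v \<Rightarrow> 'v"
    and s :: nat and m :: "nat \<Rightarrow> nat"
    and b :: "R_index \<Rightarrow> 'v"
    and \<Delta> :: "'v \<Rightarrow> 'v"
  assumes "s \<ge> 1"
    and "\<forall>t\<in>{1..s}. \<forall>u\<in>{1..s}. t \<le> u \<longrightarrow> m t \<ge> m u"
    and "\<forall>t\<in>{1..s}. m t \<ge> 1"
    and "R_algebra scale bracket s m b"
    and "leibniz_algebra.local_derivation scale bracket \<Delta>"
  shows "leibniz_algebra.derivation scale bracket \<Delta>"
proof -
  interpret R_algebra scale bracket s m b by (rule assms(4))
  interpret R_algebra_longest_first scale bracket s m b
    using assms(1-3) by unfold_locales auto
  show ?thesis using assms(5) by (rule local_derivation_imp_derivation)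
qed

end
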